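(* Let $(V,E,r,s,d,\le)$ be an ordered Bratteli diagram whose underlying Bratteli diagram $(V,E,r,s,d)$ is simple and satisfies $|E_n|>1$ for infinitely many $n$. Then the set $X_{min}$ of minimal infinite paths and the set $X_{max}$ of maximal infinite paths are disjoint.
   Context: A (labelled) Bratteli diagram $(V,E,r,s,d)$ is an infinite directed graph with $V=\bigsqcup_{n\ge 0}V_n$, $E=\bigsqcup_{n\ge1}E_n$, all $V_n,E_n$ finite and nonempty, with $s(e)\in V_{n-1}$ and $r(e)\in V_n$ for $e\in E_n$; $s^{-1}(v)\ne\varnothing$ for all $v$, $r^{-1}(v)\neq\varnothing$ for all $v\notin V_0$; and a labelling $d:V\to\mathbb N$ with $d(v)=\sum_{r(e)=v}d(s(e))$ for $v\notin V_0$. It is simple if for any $n$ and any $v\in V_n$ there exists $m>n$ such that there is a path from $v$ to every vertex of $V_m$. An ordered Bratteli diagram $(V,E,r,s,d,\le)$ is a Bratteli diagram with a partial order on $E$ such that $e,e'$ are comparable if and only if $r(e)=r(e')$. An infinite path is an infinite sequence of composable edges $(e_1,e_2,\dots)$, $e_n\in E_n$, starting at $V_0$. It is maximal (resp. minimal) if each $e_n$ is a maximal (resp. minimal) edge, i.e. maximal (resp. minimal) in $r^{-1}(r(e_n))$. *)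

theory Defs
  imports "HOL-Library.Disjoint_Sets" "Graph_Theory.Arc_Walk"
begin

text \<open>
  The levels are given as families \<open>V\<close>, \<open>E\<close> of subsets of ambient types of vertices and edges.
  Edge levels start at 1; the value \<open>E 0\<close> is never used.
\<close>

definition edges :: "(nat \<Rightarrow> 'e set) \<Rightarrow> 'e set" where
  "edges E = (\<Union>n\<in>{1..}. E n)"

definition vertices :: "(nat \<Rightarrow> 'v set) \<Rightarrow> 'v set" where
  "vertices V = (\<Union>n. V n)"

definition bratteli_graph ::
  "(nat \<Rightarrow> 'v set) \<Rightarrow> (nat \<Rightarrow> 'e set) \<Rightarrow> ('e \<Rightarrow> 'v) \<Rightarrow> ('e \<Rightarrow> 'v) \<Rightarrow> ('v, 'e) pre_digraph" where
  "bratteli_graph V E r s = \<lparr>verts = vertices V, arcs = edges E, tail = s, head = r\<rparr>"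

locale bratteli_diagram =
  fixes V :: "nat \<Rightarrow> 'v set" and E :: "nat \<Rightarrow> 'e set"
    and r s :: "'e \<Rightarrow> 'v" and d :: "'v \<Rightarrow> nat"
  assumes disjoint_V: "disjoint_family V"
    and disjoint_E: "disjoint_family_on E {1..}"
    and finite_V: "finite (V n)"
    and nonempty_V: "V n \<noteq> {}"
    and finite_E: "n \<ge> 1 \<Longrightarrow> finite (E n)"
    and nonempty_E: "n \<ge> 1 \<Longrightarrow> E n \<noteq> {}"
    and source_in: "\<lbrakk>n \<ge> 1; e \<in> E n\<rbrakk> \<Longrightarrow> s e \<in> V (n - 1)"
    and range_in: "\<lbrakk>n \<ge> 1; e \<in> E n\<rbrakk> \<Longrightarrow> r e \<in> V n"
    and no_sinks: "v \<in> vertices V \<Longrightarrow> {e \<in> edges E. s e = v} \<noteq> {}"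
    and no_sources: "v \<in> vertices V - V 0 \<Longrightarrow> {e \<in> edges E. r e = v} \<noteq> {}"
    and label: "v \<in> vertices V - V 0 \<Longrightarrow> d v = (\<Sum>e | e \<in> edges E \<and> r e = v. d (s e))"

definition simple_bratteli ::
  "(nat \<Rightarrow> 'v set) \<Rightarrow> (nat \<Rightarrow> 'e set) \<Rightarrow> ('e \<Rightarrow> 'v) \<Rightarrow> ('e \<Rightarrow> 'v) \<Rightarrow> bool" where
  "simple_bratteli V E r s \<longleftrightarrow>
     (\<forall>n. \<forall>v\<in>V n. \<exists>m>n. \<forall>w\<in>V m. \<exists>p. pre_digraph.awalk (bratteli_graph V E r s) v p w)"

locale ordered_bratteli_diagram = bratteli_diagram V E r s d
  for V :: "nat \<Rightarrow> 'v set" and E :: "nat \<Rightarrow> 'e set"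
    and r s :: "'e \<Rightarrow> 'v" and d :: "'v \<Rightarrow> nat" +
  fixes le :: "('e \<times> 'e) set"
  assumes partial_order: "partial_order_on (edges E) le"
    and comparable_iff:
      "\<lbrakk>e \<in> edges E; e' \<in> edges E\<rbrakk> \<Longrightarrow> (e, e') \<in> le \<or> (e', e) \<in> le \<longleftrightarrow> r e = r e'"

definition maximal_edge :: "(nat \<Rightarrow> 'e set) \<Rightarrow> ('e \<Rightarrow> 'v) \<Rightarrow> ('e \<times> 'e) set \<Rightarrow> 'e \<Rightarrow> bool" where
  "maximal_edge E r le e \<longleftrightarrow>
     e \<in> edges E \<and> (\<forall>e'\<in>edges E. r e' = r e \<longrightarrow> (e, e') \<in> le \<longrightarrow> e' = e)"

definition minimal_edge :: "(nat \<Rightarrow> 'e set) \<Rightarrow> ('e \<Rightarrow> 'v) \<Rightarrow> ('e \<times> 'e) set \<Rightarrow> 'e \<Rightarrow> bool" where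
  "minimal_edge E r le e \<longleftrightarrow>
     e \<in> edges E \<and> (\<forall>e'\<in>edges E. r e' = r e \<longrightarrow> (e', e) \<in> le \<longrightarrow> e' = e)"

text \<open>The path \<open>(e\<^sub>1, e\<^sub>2, \<dots>)\<close> is the function \<open>x\<close> with \<open>x n = e\<^sub>n\<^sub>+\<^sub>1\<close>.\<close>

definition infinite_paths ::
  "(nat \<Rightarrow> 'v set) \<Rightarrow> (nat \<Rightarrow> 'e set) \<Rightarrow> ('e \<Rightarrow> 'v) \<Rightarrow> ('e \<Rightarrow> 'v) \<Rightarrow> (nat \<Rightarrow> 'e) set" where
  "infinite_paths V E r s =
     {x. (\<forall>n. x n \<in> E (Suc n)) \<and> (\<forall>n. r (x n) = s (x (Suc n))) \<and> s (x 0) \<in> V 0}"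

definition X_min ::
  "(nat \<Rightarrow> 'v set) \<Rightarrow> (nat \<Rightarrow> 'e set) \<Rightarrow> ('e \<Rightarrow> 'v) \<Rightarrow> ('e \<Rightarrow> 'v) \<Rightarrow> ('e \<times> 'e) set \<Rightarrow> (nat \<Rightarrow> 'e) set"
  where "X_min V E r s le = {x \<in> infinite_paths V E r s. \<forall>n. minimal_edge E r le (x n)}"

definition X_max ::
  "(nat \<Rightarrow> 'v set) \<Rightarrow> (nat \<Rightarrow> 'e set) \<Rightarrow> ('e \<Rightarrow> 'v) \<Rightarrow> ('e \<Rightarrow> 'v) \<Rightarrow> ('e \<times> 'e) set \<Rightarrow> (nat \<Rightarrow> 'e) set"
  where "X_max V E r s le = {x \<in> infinite_paths V E r s. \<forall>n. maximal_edge E r le (x n)}"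

end

theory Submission
  imports Defs
begin

text \<open>
  Suppose that an infinite path \<open>x\<close> is both minimal and maximal. The edges with a given range are
  totally ordered, so each edge of \<open>x\<close> is the only edge into its range. Following any finite walk
  backwards from a vertex of \<open>x\<close> therefore never leaves \<open>x\<close>: the vertices from which \<open>x\<close> can be
  reached are the vertices of \<open>x\<close> themselves. In a simple diagram every vertex reaches \<open>x\<close>, because
  it reaches a whole level and \<open>x\<close> passes through every level. Hence each level consists of a single
  vertex of \<open>x\<close>, and \<open>E n\<close>, whose edges all end at the vertex of level \<open>n\<close>, consists of a single
  edge of \<open>x\<close> for every \<open>n \<ge> 1\<close>, contrary to the hypothesis on \<open>card (E n)\<close>.
\<close>

context bratteli_diagram
begin

lemma level_unique:
  assumes "v \<in> V m" and "v \<in> V n"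
  shows "m = n"
  using disjoint_V assms by (auto simp: disjoint_family_on_def)

lemma infinite_path_source_level:
  assumes "x \<in> infinite_paths V E r s"
  shows "s (x n) \<in> V n"
  using assms source_in[of "Suc n" "x n"] by (simp add: infinite_paths_def)

text \<open>
  Induction along the walk, from its end on \<open>x\<close> backwards: a step that enters \<open>x\<close> ends at a vertex of
  positive level, whose only incoming edge lies on \<open>x\<close>.
\<close>

lemma walk_into_path_starts_on_path:
  assumes path: "x \<in> infinite_paths V E r s"
    and only: "\<And>n e. e \<in> edges E \<Longrightarrow> r e = r (x n) \<Longrightarrow> e = x n"
    and walk: "pre_digraph.awalk (bratteli_graph V E r s) w p (s (x m))"
  shows "\<exists>k. w = s (x k)"
proof -
  have "set p \<subseteq> edges E" and "pre_digraph.cas (bratteli_graph V E r s) w p (s (x m))"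
    using walk by (auto simp: pre_digraph.awalk_def bratteli_graph_def)
  then show ?thesis
  proof (induction p arbitrary: w)
    case Nil
    then show ?case by (auto simp: pre_digraph.cas.simps)
  next
    case (Cons e p)
    then have e: "e \<in> edges E" "s e = w"
      and "pre_digraph.cas (bratteli_graph V E r s) (r e) p (s (x m))"
      by (auto simp: pre_digraph.cas.simps bratteli_graph_def)
    with Cons obtain k where k: "r e = s (x k)" by auto
    obtain j where j: "j \<ge> 1" "e \<in> E j" using e by (auto simp: edges_def)
    have "k = j"
      using level_unique k range_in[OF j] infinite_path_source_level[OF path] by metis
    then obtain i where "k = Suc i" using j by (cases k) auto
    then have "r e = r (x i)" using k path by (simp add: infinite_paths_def)
    then have "e = x i" using only e by blast
    then show ?case using e by blast
  qed
qed

text \<open>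
  A vertex \<open>w\<close> of level \<open>n\<close> reaches all of some later level, in particular the vertex of \<open>x\<close> there,
  so \<open>w\<close> is itself on \<open>x\<close>; disjointness of the levels then determines which vertex of \<open>x\<close> it is.
\<close>

lemma simple_level_eq_path_vertex:
  assumes simple: "simple_bratteli V E r s"
    and path: "x \<in> infinite_paths V E r s"
    and only: "\<And>n e. e \<in> edges E \<Longrightarrow> r e = r (x n) \<Longrightarrow> e = x n"
  shows "V n = {s (x n)}"
proof -
  have "w = s (x n)" if w: "w \<in> V n" for w
  proof -
    obtain m where "\<forall>v\<in>V m. \<exists>p. pre_digraph.awalk (bratteli_graph V E r s) w p v"
      using simple w unfolding simple_bratteli_def by blast
    then obtain p where "pre_digraph.awalk (bratteli_graph V E r s) w p (s (x m))"
      using infinite_path_source_level[OF path] by blast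
    then obtain k where k: "w = s (x k)"
      using walk_into_path_starts_on_path[OF path only] by blast
    then have "k = n"
      using level_unique w infinite_path_source_level[OF path] by metis
    then show ?thesis using k by simp
  qed
  then show ?thesis using infinite_path_source_level[OF path] by blast
qed

lemma simple_edges_eq_path_edge:
  assumes "simple_bratteli V E r s"
    and path: "x \<in> infinite_paths V E r s"
    and only: "\<And>n e. e \<in> edges E \<Longrightarrow> r e = r (x n) \<Longrightarrow> e = x n"
  shows "E (Suc n) = {x n}"
proof -
  have "e = x n" if e: "e \<in> E (Suc n)" for e
  proof (rule only)
    show "e \<in> edges E" using e by (auto simp: edges_def)
    have "r e \<in> V (Suc n)" using range_in e by simp
    then show "r e = r (x n)"
      using simple_level_eq_path_vertex[OF assms, of "Suc n"] path
      by (simp add: infinite_paths_def)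
  qed
  then show ?thesis using path by (auto simp: infinite_paths_def)
qed

end

lemma (in ordered_bratteli_diagram) minimal_maximal_edge_unique:
  assumes "minimal_edge E r le f" and "maximal_edge E r le f"
    and "e \<in> edges E" and "r e = r f"
  shows "e = f"
  using assms comparable_iff[of e f] unfolding minimal_edge_def maximal_edge_def by blast

theorem proposition6p6:
  fixes V :: "nat \<Rightarrow> 'v set" and E :: "nat \<Rightarrow> 'e set"
    and r s :: "'e \<Rightarrow> 'v" and d :: "'v \<Rightarrow> nat" and le :: "('e \<times> 'e) set"
  assumes "ordered_bratteli_diagram V E r s d le"
    and "simple_bratteli V E r s"
    and "infinite {n. n \<ge> 1 \<and> card (E n) > 1}"
  shows "X_min V E r s le \<inter> X_max V E r s le = {}"
proof (rule ccontr)
  interpret ordered_bratteli_diagram V E r s d le by (rule assms(1))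
  assume "X_min V E r s le \<inter> X_max V E r s le \<noteq> {}"
  then obtain x where path: "x \<in> infinite_paths V E r s"
    and min: "\<And>n. minimal_edge E r le (x n)" and max: "\<And>n. maximal_edge E r le (x n)"
    by (auto simp: X_min_def X_max_def)
  have only: "e = x n" if "e \<in> edges E" "r e = r (x n)" for n e
    using minimal_maximal_edge_unique[OF min max] that .
  obtain n where n: "n \<ge> 1" "card (E n) > 1"
    using infinite_imp_nonempty[OF assms(3)] by blast
  then obtain i where "n = Suc i" by (cases n) auto
  then show False
    using simple_edges_eq_path_edge[OF assms(2) path only, of i] n by simp
qed

end
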